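(* There exist $f,g,h\in\mathcal{A}(\mathbb{R}^2)$ such that $f=(g\oplus h)^c$, $g=(h\oplus f)^c$, but $h\ne(f\oplus g)^c$.
   Context: $\mathcal{A}(\mathbb{R}^2)$ denotes the set of proper, lower-semicontinuous, convex functions $\mathbb{R}^2\to\mathbb{R}\cup\{+\infty\}$. For proper functions $\varphi,\psi:\mathbb{R}^2\to\mathbb{R}\cup\{+\infty\}$, $$(\varphi\oplus\psi)^c(z):=\sup_{x,y\in\mathbb{R}^2}\big(x\cdot y+y\cdot z+z\cdot x-\varphi(x)-\psi(y)\big),\quad z\in\mathbb{R}^2.$$ *)

theory Defs
  imports "HOL-Analysis.Analysis"
begin

definition proper :: "('a \<Rightarrow> ereal) \<Rightarrow> bool"
  where "proper f \<longleftrightarrow> (\<forall>x. f x \<noteq> -\<infinity>) \<and> (\<exists>x. f x \<noteq> \<infinity>)"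

definition lower_semicontinuous :: "('a::topological_space \<Rightarrow> ereal) \<Rightarrow> bool"
  where "lower_semicontinuous f \<longleftrightarrow> (\<forall>x. f x \<le> Liminf (at x) f)"

text \<open>The library's \<^const>\<open>convex_on\<close> covers only real-valued functions. In \<^typ>\<open>ereal\<close>
  we have \<^prop>\<open>0 * \<infinity> = (0::ereal)\<close>, so the endpoint cases \<open>u = 0\<close> and \<open>v = 0\<close> hold
  trivially. The inequality is meant for functions that omit the value \<open>-\<infinity>\<close>.\<close>

definition convex_ereal :: "('a::real_vector \<Rightarrow> ereal) \<Rightarrow> bool"
  where "convex_ereal f \<longleftrightarrow>
    (\<forall>x y. \<forall>u\<ge>0. \<forall>v\<ge>0. u + v = 1 \<longrightarrow>
      f (u *\<^sub>R x + v *\<^sub>R y) \<le> ereal u * f x + ereal v * f y)"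

definition proper_lsc_convex :: "('a::real_normed_vector \<Rightarrow> ereal) set" (\<open>\<A>\<close>)
  where "\<A> = {f. proper f \<and> lower_semicontinuous f \<and> convex_ereal f}"

text \<open>For \<open>\<phi>\<close> and \<open>\<psi>\<close> omitting the value \<open>-\<infinity>\<close> the difference below never involves
  \<open>\<infinity> - \<infinity>\<close>: it is \<open>-\<infinity>\<close> as soon as \<open>\<phi> x\<close> or \<open>\<psi> y\<close> is \<open>\<infinity>\<close>.\<close>

definition oplus_conj ::
    "('a::real_inner \<Rightarrow> ereal) \<Rightarrow> ('a \<Rightarrow> ereal) \<Rightarrow> 'a \<Rightarrow> ereal" (\<open>'(_ \<oplus> _')\<^sup>c\<close>)
  where "(\<phi> \<oplus> \<psi>)\<^sup>c = (\<lambda>z. SUP (x, y). ereal (x \<bullet> y + y \<bullet> z + z \<bullet> x) - \<phi> x - \<psi> y)"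

end

theory Submission
  imports Defs
begin

text \<open>
  Take for \<open>h\<close> the indicator of the square \<open>[-1,1]\<^sup>2\<close>, whose convex conjugate is the
  \<open>l\<^sub>1\<close> norm. Then \<open>f = (g \<oplus> h)\<^sup>c\<close> and \<open>g = (h \<oplus> f)\<^sup>c\<close> say that \<open>f\<close> and \<open>g\<close> are
  conjugate to each other for the single cost \<open>c(x,y) = x \<bullet> y + \<bar>x\<^sub>1 + y\<^sub>1\<bar> + \<bar>x\<^sub>2 + y\<^sub>2\<bar>\<close>.
  Taking the conjugate of any function and then conjugating again yields such a pair; starting
  from the indicator of the two points \<open>\<plusminus>(1,1)\<close> gives \<open>f(x) = max (c(x,(1,1))) (c(x,-(1,1)))\<close>. Along the crease
  \<open>x\<^sub>1 + x\<^sub>2 = 0\<close> this \<open>f\<close> equals the \<open>l\<^sub>1\<close> norm outside a bounded set, which forces its conjugate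
  \<open>g\<close> to be infinite off the diagonal; in the diagonal direction \<open>f\<close> grows faster by
  \<open>\<bar>x\<^sub>1 + x\<^sub>2\<bar>\<close>, and \<open>g\<close> turns out to be the indicator of the segment from
  \<open>-(1,1)\<close> to \<open>(1,1)\<close>.

  The third identity fails at the origin: there \<open>h\<close> vanishes, whereas
  \<open>f(x) \<ge> \<bar>x\<^sub>1 + x\<^sub>2\<bar> + 2\<close> for all \<open>x\<close> (\<open>ridge_ge\<close>) gives
  \<open>x \<bullet> y - f(x) \<le> -2\<close> for every \<open>y\<close> on the segment.
\<close>

section \<open>Membership in the class of proper lsc convex functions\<close>

text \<open>The indicator function of a set in the sense of convex analysis.\<close>

definition set_indicator :: "'a set \<Rightarrow> 'a \<Rightarrow> ereal"
  where "set_indicator C x = (if x \<in> C then 0 else \<infinity>)"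

lemma set_indicator_in_proper_lsc_convex:
  fixes C :: "'a::real_normed_vector set"
  assumes "closed C" "convex C" "C \<noteq> {}"
  shows "set_indicator C \<in> \<A>"
proof -
  have "proper (set_indicator C)"
    using assms(3) by (auto simp: proper_def set_indicator_def)
  moreover have "set_indicator C x \<le> Liminf (at x) (set_indicator C)" for x
  proof (rule Liminf_bounded)
    show "eventually (\<lambda>y. set_indicator C x \<le> set_indicator C y) (at x)"
    proof (cases "x \<in> C")
      case False
      then have "eventually (\<lambda>y. y \<in> - C) (at x)"
        using assms(1) by (intro eventually_at_in_open') auto
      then show ?thesis
        by (rule eventually_mono) (simp add: set_indicator_def)
    qed (simp add: set_indicator_def)
  qed
  moreover have "convex_ereal (set_indicator C)"
    unfolding convex_ereal_def
  proof (intro allI impI)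
    fix x y and u v :: real
    assume uv: "0 \<le> u" "0 \<le> v" "u + v = 1"
    consider "u = 0" | "v = 0" | "u > 0" "v > 0"
      using uv by linarith
    then show "set_indicator C (u *\<^sub>R x + v *\<^sub>R y)
        \<le> ereal u * set_indicator C x + ereal v * set_indicator C y"
    proof cases
      case 3
      then show ?thesis
        using convexD[OF assms(2) _ _ uv] by (auto simp: set_indicator_def)
    qed (use uv in \<open>simp_all flip: zero_ereal_def one_ereal_def\<close>)
  qed
  ultimately show ?thesis
    by (simp add: proper_lsc_convex_def lower_semicontinuous_def)
qed

lemma real_convex_in_proper_lsc_convex:
  fixes f :: "'a::euclidean_space \<Rightarrow> real"
  assumes "convex_on UNIV f"
  shows "(\<lambda>x. ereal (f x)) \<in> \<A>"
proof -
  have "continuous_on UNIV f"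
    using convex_on_continuous[OF open_UNIV assms] .
  then have "((\<lambda>y. ereal (f y)) \<longlongrightarrow> ereal (f x)) (at x)" for x
    by (simp add: continuous_on_def)
  then have "Liminf (at x) (\<lambda>y. ereal (f y)) = ereal (f x)" for x
    by (intro lim_imp_Liminf) auto
  moreover have "f (u *\<^sub>R x + v *\<^sub>R y) \<le> u * f x + v * f y"
    if "0 \<le> u" "0 \<le> v" "u + v = 1" for x y u v
    using assms that by (simp add: convex_on_def)
  ultimately show ?thesis
    by (simp add: proper_lsc_convex_def lower_semicontinuous_def convex_ereal_def proper_def)
qed

section \<open>Bounds for the conjugate\<close>

lemma oplus_conj_upper:
  "ereal (x \<bullet> y + y \<bullet> z + z \<bullet> x) - \<phi> x - \<psi> y \<le> (\<phi> \<oplus> \<psi>)\<^sup>c z"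
  unfolding oplus_conj_def by (rule SUP_upper2[of "(x, y)"]) auto

lemma oplus_conj_least:
  assumes "\<And>x y. ereal (x \<bullet> y + y \<bullet> z + z \<bullet> x) - \<phi> x - \<psi> y \<le> c"
  shows "(\<phi> \<oplus> \<psi>)\<^sup>c z \<le> c"
  unfolding oplus_conj_def using assms by (auto intro: SUP_least)

section \<open>The three functions\<close>

lemma inner_real2: "(x::real^2) \<bullet> y = x $ 1 * y $ 1 + x $ 2 * y $ 2"
  by (simp add: inner_vec_def sum_2)

text \<open>In \<^typ>\<open>real^2\<close> the constant \<open>1\<close> is the vector \<open>(1,1)\<close>, so that \<open>square\<close> is
  \<open>[-1,1]\<^sup>2\<close> and \<open>diagonal\<close> joins \<open>-(1,1)\<close> to \<open>(1,1)\<close>.\<close>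

abbreviation square :: "(real^2) set"
  where "square \<equiv> cbox (-1) 1"

abbreviation diagonal :: "(real^2) set"
  where "diagonal \<equiv> closed_segment (-1) 1"

lemma mem_square: "z \<in> square \<longleftrightarrow> \<bar>z $ 1\<bar> \<le> 1 \<and> \<bar>z $ 2\<bar> \<le> 1"
  by (auto simp: mem_box_cart forall_2)

lemma mem_diagonal: "y \<in> diagonal \<longleftrightarrow> y $ 1 = y $ 2 \<and> \<bar>y $ 1\<bar> \<le> 1"
proof
  assume "y \<in> diagonal"
  then show "y $ 1 = y $ 2 \<and> \<bar>y $ 1\<bar> \<le> 1"
    by (auto simp: in_segment)
next
  assume "y $ 1 = y $ 2 \<and> \<bar>y $ 1\<bar> \<le> 1"
  then show "y \<in> diagonal"
    by (auto simp: in_segment vec_eq_iff forall_2 field_simps intro!: exI[of _ "(y $ 1 + 1) / 2"])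
qed

text \<open>The maximum over \<open>y = \<plusminus>(1,1)\<close> of the cost \<open>x \<bullet> y + \<bar>x\<^sub>1 + y\<^sub>1\<bar> + \<bar>x\<^sub>2 + y\<^sub>2\<bar>\<close>.\<close>

definition ridge :: "real^2 \<Rightarrow> real"
  where "ridge x = max (x $ 1 + x $ 2 + \<bar>x $ 1 + 1\<bar> + \<bar>x $ 2 + 1\<bar>)
                       (- x $ 1 - x $ 2 + \<bar>x $ 1 - 1\<bar> + \<bar>x $ 2 - 1\<bar>)"

lemma ridge_ge: "\<bar>x $ 1 + x $ 2\<bar> + 2 \<le> ridge x"
  unfolding ridge_def by linarith

lemma convex_ridge: "convex_on UNIV ridge"
proof (rule convex_onI)
  fix t :: real and x y :: "real^2"
  assume t: "0 < t" "t < 1"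
  \<comment> \<open>each absolute value in \<open>ridge\<close> is that of an affine function\<close>
  have abs_conv: "\<bar>(1 - t) * a + t * b + c\<bar> \<le> (1 - t) * \<bar>a + c\<bar> + t * \<bar>b + c\<bar>"
    for a b c :: real
  proof -
    have "\<bar>(1 - t) * a + t * b + c\<bar> = \<bar>(1 - t) * (a + c) + t * (b + c)\<bar>"
      by (simp add: algebra_simps)
    also have "\<dots> \<le> (1 - t) * \<bar>a + c\<bar> + t * \<bar>b + c\<bar>"
      using t by (intro order_trans[OF abs_triangle_ineq]) (simp add: abs_mult)
    finally show ?thesis .
  qed
  let ?p = "\<lambda>x::real^2. x $ 1 + x $ 2 + \<bar>x $ 1 + 1\<bar> + \<bar>x $ 2 + 1\<bar>"
  let ?m = "\<lambda>x::real^2. - x $ 1 - x $ 2 + \<bar>x $ 1 - 1\<bar> + \<bar>x $ 2 - 1\<bar>"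
  let ?w = "(1 - t) *\<^sub>R x + t *\<^sub>R y"
  have "?p ?w \<le> (1 - t) * ?p x + t * ?p y"
    using abs_conv[of "x $ 1" "y $ 1" 1] abs_conv[of "x $ 2" "y $ 2" 1]
    by (simp add: algebra_simps)
  also have "\<dots> \<le> (1 - t) * ridge x + t * ridge y"
    unfolding ridge_def using t by (intro add_mono mult_left_mono) auto
  finally have p: "?p ?w \<le> (1 - t) * ridge x + t * ridge y" .
  have "?m ?w \<le> (1 - t) * ?m x + t * ?m y"
    using abs_conv[of "x $ 1" "y $ 1" "-1"] abs_conv[of "x $ 2" "y $ 2" "-1"]
    by (simp add: algebra_simps)
  also have "\<dots> \<le> (1 - t) * ridge x + t * ridge y"
    unfolding ridge_def using t by (intro add_mono mult_left_mono) auto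
  finally have m: "?m ?w \<le> (1 - t) * ridge x + t * ridge y" .
  show "ridge ?w \<le> (1 - t) * ridge x + t * ridge y"
    using p m by (subst ridge_def) simp
qed simp

section \<open>The conjugacy relations\<close>

text \<open>The inequality behind both conjugacy relations.\<close>

lemma cost_le_ridge:
  assumes y: "y \<in> diagonal" and z: "z \<in> square"
  shows "x \<bullet> y + y \<bullet> z + z \<bullet> x \<le> ridge x"
proof -
  define a where "a = y $ 1"
  have a: "y $ 1 = a" "y $ 2 = a" "\<bar>a\<bar> \<le> 1"
    using y by (auto simp: a_def mem_diagonal)
  have abs: "u * v \<le> \<bar>v\<bar>" if "\<bar>u\<bar> \<le> 1" for u v :: real
    using mult_right_mono[OF that, of "\<bar>v\<bar>"] by (simp flip: abs_mult)
  let ?c = "\<lambda>a. a * (x $ 1 + x $ 2) + \<bar>x $ 1 + a\<bar> + \<bar>x $ 2 + a\<bar>"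
  have "x \<bullet> y + y \<bullet> z + z \<bullet> x
      = a * (x $ 1 + x $ 2) + z $ 1 * (x $ 1 + a) + z $ 2 * (x $ 2 + a)"
    by (simp add: inner_real2 a algebra_simps)
  also have "\<dots> \<le> ?c a"
    using abs[of "z $ 1" "x $ 1 + a"] abs[of "z $ 2" "x $ 2 + a"] z
    by (simp add: mem_square)
  \<comment> \<open>\<open>?c\<close> is convex, and \<open>a\<close> is a convex combination of \<open>1\<close> and \<open>-1\<close>\<close>
  also have "\<dots> \<le> (1 + a) / 2 * ?c 1 + (1 - a) / 2 * ?c (-1)"
  proof -
    have "\<bar>r + a\<bar> \<le> (1 + a) / 2 * \<bar>r + 1\<bar> + (1 - a) / 2 * \<bar>r - 1\<bar>" for r :: real
    proof -
      have "\<bar>r + a\<bar> = \<bar>(1 + a) / 2 * (r + 1) + (1 - a) / 2 * (r - 1)\<bar>"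
        by (rule arg_cong[of _ _ abs]) (simp add: field_simps)
      also have "\<dots> \<le> (1 + a) / 2 * \<bar>r + 1\<bar> + (1 - a) / 2 * \<bar>r - 1\<bar>"
        using a(3) by (intro order_trans[OF abs_triangle_ineq]) (simp add: abs_mult)
      finally show ?thesis .
    qed
    from this[of "x $ 1"] this[of "x $ 2"] show ?thesis
      by (simp add: field_simps)
  qed
  also have "\<dots> \<le> (1 + a) / 2 * ridge x + (1 - a) / 2 * ridge x"
    using a(3) by (intro add_mono mult_left_mono) (auto simp: ridge_def)
  also have "\<dots> = ridge x"
    by (simp add: field_simps)
  finally show ?thesis .
qed

lemma ridge_eq_conj:
  "(\<lambda>x. ereal (ridge x)) = (set_indicator diagonal \<oplus> set_indicator square)\<^sup>c"
proof (rule ext, rule antisym)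
  fix x :: "real^2"
  let ?conj = "(set_indicator diagonal \<oplus> set_indicator square)\<^sup>c x"
  show "?conj \<le> ereal (ridge x)"
    using cost_le_ridge[of _ _ x]
    by (intro oplus_conj_least) (auto simp: set_indicator_def algebra_simps inner_commute)
  have lower: "ereal (y \<bullet> z + z \<bullet> x + x \<bullet> y) \<le> ?conj"
    if "y \<in> diagonal" "z \<in> square" for y z
    using oplus_conj_upper[of y z x "set_indicator diagonal" "set_indicator square"] that
    by (simp add: set_indicator_def)
  \<comment> \<open>the signs of \<open>x + y\<close> give the vertex \<open>z\<close> of the square that realises the \<open>l\<^sub>1\<close> norm\<close>
  define z where "z s = (vector [if x $ 1 + s \<ge> 0 then 1 else -1,
      if x $ 2 + s \<ge> 0 then 1 else -1] :: real^2)" for s :: real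
  have z: "z s \<in> square" for s
    by (simp add: z_def mem_square)
  have "x $ 1 + x $ 2 + \<bar>x $ 1 + 1\<bar> + \<bar>x $ 2 + 1\<bar> = 1 \<bullet> z 1 + z 1 \<bullet> x + x \<bullet> 1"
    by (simp add: inner_real2 z_def)
  moreover have "- x $ 1 - x $ 2 + \<bar>x $ 1 - 1\<bar> + \<bar>x $ 2 - 1\<bar>
      = (-1) \<bullet> z (-1) + z (-1) \<bullet> x + x \<bullet> (-1)"
    by (simp add: inner_real2 z_def)
  ultimately show "ereal (ridge x) \<le> ?conj"
    using lower[of 1 "z 1"] lower[of "-1" "z (-1)"] z unfolding ridge_def
    by (auto simp: max_def)
qed

lemma diagonal_eq_conj:
  "set_indicator diagonal = (set_indicator square \<oplus> (\<lambda>x. ereal (ridge x)))\<^sup>c"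
proof (rule ext)
  fix y :: "real^2"
  let ?conj = "(set_indicator square \<oplus> (\<lambda>x. ereal (ridge x)))\<^sup>c y"
  have lower: "ereal (z \<bullet> x + x \<bullet> y + y \<bullet> z - ridge x) \<le> ?conj" if "z \<in> square" for z x
    using oplus_conj_upper[of z x y "set_indicator square" "\<lambda>x. ereal (ridge x)"] that
    by (simp add: set_indicator_def)
  have infinite: "?conj = \<infinity>"
    if "k > 0" "\<And>t. t \<ge> 1 \<Longrightarrow> ereal (k * t) \<le> ?conj" for k :: real
  proof (rule ereal_top)
    fix B :: real
    have "B \<le> k * max 1 (B / k)"
      using that(1) by (simp add: max_def field_simps)
    also have "ereal (k * max 1 (B / k)) \<le> ?conj"
      by (rule that(2)) simp
    finally show "ereal B \<le> ?conj" by simp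
  qed
  consider "y \<in> diagonal" | "y $ 1 > y $ 2" | "y $ 1 < y $ 2"
    | "y $ 1 = y $ 2" "y $ 1 > 1" | "y $ 1 = y $ 2" "y $ 1 < -1"
    by (fastforce simp: mem_diagonal)
  then show "set_indicator diagonal y = ?conj"
  proof cases
    case 1
    have "?conj \<le> 0"
      using cost_le_ridge[OF 1]
      by (intro oplus_conj_least) (auto simp: set_indicator_def algebra_simps inner_commute)
    \<comment> \<open>equality in \<open>cost_le_ridge\<close> holds at the crease point \<open>x = (1,-1)\<close>\<close>
    moreover have "0 \<le> ?conj"
      using lower[of "vector [1, -1]" "vector [1, -1]"] 1
      by (simp add: mem_square mem_diagonal inner_real2 ridge_def zero_ereal_def)
    ultimately show ?thesis
      using 1 by (simp add: set_indicator_def)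
  next
    \<comment> \<open>off the line \<open>y\<^sub>1 = y\<^sub>2\<close>, moving along the crease makes the supremum infinite\<close>
    case 2
    have "ereal ((y $ 1 - y $ 2) * t) \<le> ?conj" if "t \<ge> 1" for t
      using 2 that
      by (intro order_trans[OF _ lower[of "vector [1, -1]" "vector [t, -t]"]])
        (simp_all add: mem_square inner_real2 ridge_def algebra_simps)
    then show ?thesis
      using 2 infinite[of "y $ 1 - y $ 2"] by (simp add: set_indicator_def mem_diagonal)
  next
    case 3
    have "ereal ((y $ 2 - y $ 1) * t) \<le> ?conj" if "t \<ge> 1" for t
      using 3 that
      by (intro order_trans[OF _ lower[of "vector [-1, 1]" "vector [-t, t]"]])
        (simp_all add: mem_square inner_real2 ridge_def algebra_simps)
    then show ?thesis
      using 3 infinite[of "y $ 2 - y $ 1"] by (simp add: set_indicator_def mem_diagonal)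
  next
    \<comment> \<open>beyond the ends of the segment, moving along the diagonal does\<close>
    case 4
    have "ereal (2 * (y $ 1 - 1) * t) \<le> ?conj" if "t \<ge> 1" for t
      using 4 that
      by (intro order_trans[OF _ lower[of 1 "vector [t, t]"]])
        (simp_all add: mem_square inner_real2 ridge_def algebra_simps)
    then show ?thesis
      using 4 infinite[of "2 * (y $ 1 - 1)"] by (simp add: set_indicator_def mem_diagonal)
  next
    case 5
    have "ereal (2 * (- y $ 1 - 1) * t) \<le> ?conj" if "t \<ge> 1" for t
      using 5 that
      by (intro order_trans[OF _ lower[of "-1" "vector [-t, -t]"]])
        (simp_all add: mem_square inner_real2 ridge_def algebra_simps)
    then show ?thesis
      using 5 infinite[of "2 * (- y $ 1 - 1)"] by (simp add: set_indicator_def mem_diagonal)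
  qed
qed

lemma conj_at_origin_le:
  "((\<lambda>x. ereal (ridge x)) \<oplus> set_indicator diagonal)\<^sup>c 0 \<le> -2"
proof (rule oplus_conj_least)
  fix x y :: "real^2"
  have "x \<bullet> y - ridge x \<le> -2" if "y \<in> diagonal"
  proof -
    have "x \<bullet> y = y $ 1 * (x $ 1 + x $ 2)"
      using that by (simp add: mem_diagonal inner_real2 algebra_simps)
    also have "\<dots> \<le> \<bar>y $ 1\<bar> * \<bar>x $ 1 + x $ 2\<bar>"
      by (simp flip: abs_mult)
    also have "\<dots> \<le> 1 * \<bar>x $ 1 + x $ 2\<bar>"
      using that by (intro mult_right_mono) (auto simp: mem_diagonal)
    finally show ?thesis
      using ridge_ge[of x] by simp
  qed
  then show "ereal (x \<bullet> y + y \<bullet> 0 + 0 \<bullet> x) - ereal (ridge x) - set_indicator diagonal y \<le> -2"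
    by (auto simp: set_indicator_def)
qed

theorem proposition1p9:
  shows "\<exists>f g h :: real ^ 2 \<Rightarrow> ereal. f \<in> \<A> \<and> g \<in> \<A> \<and> h \<in> \<A> \<and>
    f = (g \<oplus> h)\<^sup>c \<and> g = (h \<oplus> f)\<^sup>c \<and> h \<noteq> (f \<oplus> g)\<^sup>c"
proof (intro exI conjI)
  let ?f = "\<lambda>x. ereal (ridge x)"
  let ?g = "set_indicator diagonal"
  let ?h = "set_indicator square"
  show "?f \<in> \<A>"
    by (rule real_convex_in_proper_lsc_convex[OF convex_ridge])
  show "?g \<in> \<A>"
    by (rule set_indicator_in_proper_lsc_convex) auto
  have "0 \<in> square"
    by (simp add: mem_square)
  then show "?h \<in> \<A>"
    by (intro set_indicator_in_proper_lsc_convex) auto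
  show "?f = (?g \<oplus> ?h)\<^sup>c"
    by (rule ridge_eq_conj)
  show "?g = (?h \<oplus> ?f)\<^sup>c"
    by (rule diagonal_eq_conj)
  have "?h 0 = 0"
    using \<open>0 \<in> square\<close> by (simp add: set_indicator_def)
  then show "?h \<noteq> (?f \<oplus> ?g)\<^sup>c"
    using conj_at_origin_le by auto
qed

end
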